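(* Let $(X,\alpha)$ be an algebra of the monad $\mathcal V_w$ on the category $\mathbf{TOP}_0$. Then $X$, with the cone structure induced by $(X,\alpha)$, is a weakly locally convex sober topological cone.
   Context: $\mathbb R_+=[0,\infty)$ and $\overline{\mathbb R}_+=[0,\infty]$, both with the Scott topology (proper nonempty opens are the sets of elements $>r$, $r\in\mathbb R_+$). $\mathbf{TOP}_0$ is the category of $T_0$ topological spaces and continuous maps. Valuations. A continuous valuation on a space $X$ with lattice of opens $\mathcal OX$ is a map $\mu\colon\mathcal OX\to\overline{\mathbb R}_+$ with $\mu(\emptyset)=0$, $\mu(U)\le\mu(V)$ if $U\subseteq V$, $\mu(U)+\mu(V)=\mu(U\cup V)+\mu(U\cap V)$, and $\mu(\bigcup_iU_i)=\sup_i\mu(U_i)$ for directed families of opens. $\delta_x(U)=1$ if $x\in U$, and $0$ otherwise. Linear combinations of valuations are formed pointwise. $\mathcal V_wX$ is the set of all continuous valuations on $X$ with the weak topology, generated by the subbasic sets $[U>r]=\{\mu\mid\mu(U)>r\}$, $U\in\mathcal OX$, $r\in\mathbb R_+$. For continuous $h\colon X\to\overline{\mathbb R}_+$, $\int h\,d\mu=\int_0^\infty\mu(h^{-1}((r,\infty]))\,dr$ (Riemann integral). The monad. $\mathcal V_w$ is an endofunctor with $\mathcal V_wf(\mu)(V)=\mu(f^{-1}(V))$; it is a monad with unit $\eta_X(x)=\delta_x$ and multiplication $m_X(\varpi)(U)=\int_{\mu\in\mathcal V_wX}\mu(U)\,d\varpi$ for $\varpi\in\mathcal V_w\mathcal V_wX$.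 An algebra of $\mathcal V_w$ on $\mathbf{TOP}_0$ is a pair $(X,\alpha)$ of a $T_0$ space $X$ and a continuous map $\alpha\colon\mathcal V_wX\to X$ with $\alpha\circ\eta_X=\mathrm{id}_X$ and $\alpha\circ m_X=\alpha\circ\mathcal V_w\alpha$. The cone structure induced by the algebra is $x+y=\alpha(\delta_x+\delta_y)$, $r\cdot x=\alpha(r\delta_x)$ for $x,y\in X$, $r\in\mathbb R_+$. Cones. A cone is a commutative monoid $(C,+,0)$ with a scalar multiplication $\mathbb R_+\times C\to C$ such that $r(x+y)=rx+ry$, $(r+s)x=rx+sx$, $(rs)x=r(sx)$, $1x=x$, $0x=0$, $r0=0$. A topological cone is a cone with a $T_0$ topology making $+$ and scalar multiplication jointly continuous. A subset $A$ of a cone is convex if $ra+(1-r)b\in A$ for all $a,b\in A$, $r\in[0,1]$. A cone with a $T_0$ topology is weakly locally convex if for every point $x$, every open neighbourhood of $x$ contains a convex (not necessarily open) neighbourhood of $x$. *)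

theory Defs
  imports "HOL-Analysis.Analysis" "HOL-Algebra.Group"
begin

definition directed_opens :: "'a topology \<Rightarrow> 'a set set \<Rightarrow> bool" where
  "directed_opens X D \<longleftrightarrow> D \<noteq> {} \<and> (\<forall>U\<in>D. openin X U) \<and>
     (\<forall>U\<in>D. \<forall>V\<in>D. \<exists>W\<in>D. U \<subseteq> W \<and> V \<subseteq> W)"

text \<open>A valuation is a map on the lattice of opens. It is encoded as a total function on
  all sets which is \<open>0\<close> outside the opens, so that equality of functions is equality of
  valuations and pointwise linear combinations need no restriction.\<close>

definition continuous_valuation :: "'a topology \<Rightarrow> ('a set \<Rightarrow> ennreal) \<Rightarrow> bool" where
  "continuous_valuation X \<mu> \<longleftrightarrow>
     (\<forall>U. \<not> openin X U \<longrightarrow> \<mu> U = 0) \<and>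
     \<mu> {} = 0 \<and>
     (\<forall>U V. openin X U \<and> openin X V \<and> U \<subseteq> V \<longrightarrow> \<mu> U \<le> \<mu> V) \<and>
     (\<forall>U V. openin X U \<and> openin X V \<longrightarrow> \<mu> U + \<mu> V = \<mu> (U \<union> V) + \<mu> (U \<inter> V)) \<and>
     (\<forall>D. directed_opens X D \<longrightarrow> \<mu> (\<Union>D) = (SUP U\<in>D. \<mu> U))"

definition dirac :: "'a topology \<Rightarrow> 'a \<Rightarrow> 'a set \<Rightarrow> ennreal" where
  "dirac X x = (\<lambda>U. if openin X U \<and> x \<in> U then 1 else 0)"

text \<open>The whole space is added to the generators because the zero valuation
  lies in none of the sets \<open>[U > r]\<close>.\<close>

definition Vw :: "'a topology \<Rightarrow> ('a set \<Rightarrow> ennreal) topology" where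
  "Vw X = topology_generated_by
     (insert {\<mu>. continuous_valuation X \<mu>}
       {{\<mu>. continuous_valuation X \<mu> \<and> \<mu> U > ennreal r} | U r. openin X U \<and> 0 \<le> r})"

lemma topspace_Vw: "topspace (Vw X) = {\<mu>. continuous_valuation X \<mu>}"
  unfolding Vw_def topology_generated_by_topspace by blast

text \<open>The integrand is a nonincreasing function of \<open>r\<close> with values in \<open>[0, \<infinity>]\<close>, hence Borel
  measurable, and its (improper) Riemann integral is its Lebesgue integral.\<close>

definition val_integral :: "'a topology \<Rightarrow> ('a set \<Rightarrow> ennreal) \<Rightarrow> ('a \<Rightarrow> ennreal) \<Rightarrow> ennreal" where
  "val_integral X \<mu> h = (\<integral>\<^sup>+r\<in>{0..}. \<mu> {x \<in> topspace X. h x > ennreal r} \<partial>lborel)"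

definition Vw_map ::
  "'a topology \<Rightarrow> 'b topology \<Rightarrow> ('a \<Rightarrow> 'b) \<Rightarrow> ('a set \<Rightarrow> ennreal) \<Rightarrow> 'b set \<Rightarrow> ennreal" where
  "Vw_map X Y f \<mu> = (\<lambda>V. if openin Y V then \<mu> {x \<in> topspace X. f x \<in> V} else 0)"

definition Vw_mult ::
  "'a topology \<Rightarrow> (('a set \<Rightarrow> ennreal) set \<Rightarrow> ennreal) \<Rightarrow> 'a set \<Rightarrow> ennreal" where
  "Vw_mult X \<omega> = (\<lambda>U. if openin X U then val_integral (Vw X) \<omega> (\<lambda>\<mu>. \<mu> U) else 0)"

definition Vw_algebra :: "'a topology \<Rightarrow> (('a set \<Rightarrow> ennreal) \<Rightarrow> 'a) \<Rightarrow> bool" where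
  "Vw_algebra X \<alpha> \<longleftrightarrow>
     t0_space X \<and>
     continuous_map (Vw X) X \<alpha> \<and>
     (\<forall>x\<in>topspace X. \<alpha> (dirac X x) = x) \<and>
     (\<forall>\<omega>\<in>topspace (Vw (Vw X)). \<alpha> (Vw_mult X \<omega>) = \<alpha> (Vw_map (Vw X) X \<alpha> \<omega>))"

definition alg_add :: "'a topology \<Rightarrow> (('a set \<Rightarrow> ennreal) \<Rightarrow> 'a) \<Rightarrow> 'a \<Rightarrow> 'a \<Rightarrow> 'a" where
  "alg_add X \<alpha> x y = \<alpha> (\<lambda>U. dirac X x U + dirac X y U)"

definition alg_smult :: "'a topology \<Rightarrow> (('a set \<Rightarrow> ennreal) \<Rightarrow> 'a) \<Rightarrow> real \<Rightarrow> 'a \<Rightarrow> 'a" where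
  "alg_smult X \<alpha> r x = \<alpha> (\<lambda>U. ennreal r * dirac X x U)"

text \<open>The neutral element is the image of the zero valuation; the cone law \<open>0 x = 0\<close>
  leaves no other choice.\<close>

definition alg_zero :: "(('a set \<Rightarrow> ennreal) \<Rightarrow> 'a) \<Rightarrow> 'a" where
  "alg_zero \<alpha> = \<alpha> (\<lambda>U. 0)"

definition is_cone ::
  "'a set \<Rightarrow> ('a \<Rightarrow> 'a \<Rightarrow> 'a) \<Rightarrow> 'a \<Rightarrow> (real \<Rightarrow> 'a \<Rightarrow> 'a) \<Rightarrow> bool" where
  "is_cone C add zero scal \<longleftrightarrow>
     Group.comm_monoid \<lparr>carrier = C, monoid.mult = add, one = zero\<rparr> \<and>
     (\<forall>r\<ge>0. \<forall>x\<in>C. scal r x \<in> C) \<and>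
     (\<forall>r\<ge>0. \<forall>x\<in>C. \<forall>y\<in>C. scal r (add x y) = add (scal r x) (scal r y)) \<and>
     (\<forall>r\<ge>0. \<forall>s\<ge>0. \<forall>x\<in>C. scal (r + s) x = add (scal r x) (scal s x)) \<and>
     (\<forall>r\<ge>0. \<forall>s\<ge>0. \<forall>x\<in>C. scal (r * s) x = scal r (scal s x)) \<and>
     (\<forall>x\<in>C. scal 1 x = x) \<and>
     (\<forall>x\<in>C. scal 0 x = zero) \<and>
     (\<forall>r\<ge>0. scal r zero = zero)"

definition scott_nonneg :: "real topology" where
  "scott_nonneg = topology (\<lambda>U. U = {} \<or> U = {0..} \<or> (\<exists>r\<ge>0. U = {r<..}))"

lemma openin_scott_nonneg:
  "openin scott_nonneg U \<longleftrightarrow> U = {} \<or> U = {0..} \<or> (\<exists>r\<ge>0. U = {r<..})"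
proof -
  define L where "L U \<longleftrightarrow> U = {} \<or> U = {0..} \<or> (\<exists>r\<ge>0. U = {r<..})" for U :: "real set"
  have L_nonneg: "S \<subseteq> {0..}" if "L S" for S
  proof -
    have "{r<..} \<subseteq> {0..}" if "r \<ge> 0" for r :: real
      using that by (simp add: subset_iff)
    with that show ?thesis
      unfolding L_def by blast
  qed
  have inter: "L (S \<inter> T)" if S: "L S" and T: "L T" for S T
  proof (cases "S = {} \<or> T = {} \<or> S = {0..} \<or> T = {0..}")
    case True
    then have "S \<inter> T = {} \<or> S \<inter> T = S \<or> S \<inter> T = T"
      using L_nonneg[OF S] L_nonneg[OF T] by blast
    with S T show ?thesis
      unfolding L_def by presburger
  next
    case False
    then obtain r s where "r \<ge> 0" "S = {r<..}" "s \<ge> 0" "T = {s<..}"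
      using S T unfolding L_def by blast
    then have "S \<inter> T = {max r s<..}" "max r s \<ge> 0"
      by (simp_all add: set_eq_iff)
    then show ?thesis
      unfolding L_def by blast
  qed
  have union: "L (\<Union>K)" if K: "\<forall>S\<in>K. L S" for K
  proof (cases "{0..} \<in> K \<or> \<Union>K = {}")
    case True
    have "\<Union>K \<subseteq> {0..}"
      using K L_nonneg by (intro Union_least) blast
    with True have "\<Union>K = {} \<or> \<Union>K = {0..}"
      by blast
    then show ?thesis
      unfolding L_def by blast
  next
    case False
    define R where "R = {r. r \<ge> 0 \<and> {r<..} \<in> K}"
    have R: "S = {} \<or> (\<exists>r\<in>R. S = {r<..})" if "S \<in> K" for S
      using K that False unfolding R_def L_def by blast
    have eq: "\<Union>K = (\<Union>r\<in>R. {r<..})"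
    proof
      show "\<Union>K \<subseteq> (\<Union>r\<in>R. {r<..})"
        using R by (intro Union_least) blast
      show "(\<Union>r\<in>R. {r<..}) \<subseteq> \<Union>K"
        unfolding R_def by blast
    qed
    have ne: "R \<noteq> {}"
      using eq False by force
    have bdd: "bdd_below R"
      by (rule bdd_belowI[of _ 0]) (simp add: R_def)
    have "\<Union>K = {Inf R<..}"
      unfolding eq by (simp add: set_eq_iff cInf_less_iff[OF ne bdd])
    moreover have "Inf R \<ge> 0"
      using ne by (rule cInf_greatest) (simp add: R_def)
    ultimately show ?thesis
      unfolding L_def by blast
  qed
  have "istopology L"
    unfolding istopology_def using inter union by blast
  then have "openin (topology L) = L"
    by (rule topology_inverse')
  moreover have "scott_nonneg = topology L"
    unfolding scott_nonneg_def L_def ..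
  ultimately show ?thesis
    by (simp only: L_def)
qed

lemma topspace_scott_nonneg: "topspace scott_nonneg = {0..}"
proof
  have "U \<subseteq> {0..}" if "openin scott_nonneg U" for U
  proof -
    have "{r<..} \<subseteq> {0..}" if "r \<ge> 0" for r :: real
      using that by (simp add: subset_iff)
    with that show ?thesis
      unfolding openin_scott_nonneg by blast
  qed
  then show "topspace scott_nonneg \<subseteq> {0..}"
    by blast
  show "{0..} \<subseteq> topspace scott_nonneg"
    by (rule openin_subset) (simp only: openin_scott_nonneg simp_thms)
qed

definition topological_cone ::
  "'a topology \<Rightarrow> ('a \<Rightarrow> 'a \<Rightarrow> 'a) \<Rightarrow> 'a \<Rightarrow> (real \<Rightarrow> 'a \<Rightarrow> 'a) \<Rightarrow> bool" where
  "topological_cone X add zero scal \<longleftrightarrow>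
     is_cone (topspace X) add zero scal \<and>
     t0_space X \<and>
     continuous_map (prod_topology X X) X (\<lambda>(x, y). add x y) \<and>
     continuous_map (prod_topology scott_nonneg X) X (\<lambda>(r, x). scal r x)"

definition cone_convex :: "('a \<Rightarrow> 'a \<Rightarrow> 'a) \<Rightarrow> (real \<Rightarrow> 'a \<Rightarrow> 'a) \<Rightarrow> 'a set \<Rightarrow> bool" where
  "cone_convex add scal A \<longleftrightarrow>
     (\<forall>a\<in>A. \<forall>b\<in>A. \<forall>r\<in>{0..1}. add (scal r a) (scal (1 - r) b) \<in> A)"

text \<open>In \<^const>\<open>neighbourhood_base_of\<close> the convex neighbourhoods need not be open.\<close>

definition weakly_locally_convex ::
  "'a topology \<Rightarrow> ('a \<Rightarrow> 'a \<Rightarrow> 'a) \<Rightarrow> (real \<Rightarrow> 'a \<Rightarrow> 'a) \<Rightarrow> bool" where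
  "weakly_locally_convex X add scal \<longleftrightarrow> neighbourhood_base_of (cone_convex add scal) X"

definition irreducible_closed :: "'a topology \<Rightarrow> 'a set \<Rightarrow> bool" where
  "irreducible_closed X C \<longleftrightarrow> closedin X C \<and> C \<noteq> {} \<and>
     (\<forall>A B. closedin X A \<and> closedin X B \<and> C \<subseteq> A \<union> B \<longrightarrow> C \<subseteq> A \<or> C \<subseteq> B)"

definition sober_space :: "'a topology \<Rightarrow> bool" where
  "sober_space X \<longleftrightarrow>
     (\<forall>C. irreducible_closed X C \<longrightarrow>
       (\<exists>!x. x \<in> topspace X \<and> C = Abstract_Topology.closure_of X {x}))"

end

theory Submission
  imports Defs
begin

text \<open>Applying the algebra law to \<open>a \<cdot> \<delta>\<^bsub>\<mu>\<^esub> + b \<cdot> \<delta>\<^bsub>\<nu>\<^esub>\<close> shows that \<open>\<alpha>\<close> is linear, so the cone laws of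
  \<open>X\<close> are inherited from those of valuations; addition and scaling are continuous because
  \<open>(x, y) \<mapsto> \<delta>\<^bsub>x\<^esub> + \<delta>\<^bsub>y\<^esub>\<close> and \<open>(r, x) \<mapsto> r \<cdot> \<delta>\<^bsub>x\<^esub>\<close> are. The basic open sets of \<open>\<V>\<^sub>w X\<close> are convex, hence so
  are their images under \<open>\<alpha>\<close>, and these images are neighbourhoods since \<open>x \<mapsto> \<delta>\<^bsub>x\<^esub>\<close> is a continuous
  section of \<open>\<alpha>\<close>. Finally, for an irreducible closed set \<open>C\<close>, the map sending an open set \<open>U\<close> to \<open>1\<close>
  if it meets \<open>C\<close> and to \<open>0\<close> otherwise is a continuous valuation, and its image under \<open>\<alpha>\<close> is the
  generic point of \<open>C\<close>.\<close>

section \<open>Continuous valuations and the weak topology\<close>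

lemma continuous_valuation_mono:
  "continuous_valuation X \<mu> \<Longrightarrow> openin X U \<Longrightarrow> openin X V \<Longrightarrow> U \<subseteq> V \<Longrightarrow> \<mu> U \<le> \<mu> V"
  unfolding continuous_valuation_def by blast

lemma continuous_valuation_modular:
  "continuous_valuation X \<mu> \<Longrightarrow> openin X U \<Longrightarrow> openin X V \<Longrightarrow>
    \<mu> U + \<mu> V = \<mu> (U \<union> V) + \<mu> (U \<inter> V)"
  unfolding continuous_valuation_def by simp

lemma continuous_valuation_zero: "continuous_valuation X (\<lambda>U. 0)"
  unfolding continuous_valuation_def directed_opens_def by simp

text \<open>Multiplication by any constant of \<open>ennreal\<close>, \<open>top\<close> included,
  preserves sums and suprema.\<close>

lemma continuous_valuation_scale:
  assumes "continuous_valuation X \<mu>"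
  shows "continuous_valuation X (\<lambda>U. a * \<mu> U)"
  using assms unfolding continuous_valuation_def
  by (simp add: mult_left_mono SUP_mult_left_ennreal[symmetric] distrib_left[symmetric])

text \<open>The work lies in continuity: a sum of two suprema ranges over pairs of members of
  \<open>D\<close>, and directedness replaces each pair by one larger member.\<close>

lemma continuous_valuation_add:
  assumes \<mu>: "continuous_valuation X \<mu>" and \<nu>: "continuous_valuation X \<nu>"
  shows "continuous_valuation X (\<lambda>U. \<mu> U + \<nu> U)"
proof -
  have "\<mu> (\<Union>D) + \<nu> (\<Union>D) = (SUP U\<in>D. \<mu> U + \<nu> U)" if D: "directed_opens X D" for D
  proof -
    have "\<exists>W\<in>D. \<mu> U + \<nu> V \<le> \<mu> W + \<nu> W" if "U \<in> D" "V \<in> D" for U V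
    proof -
      obtain W where "W \<in> D" "U \<subseteq> W" "V \<subseteq> W" "openin X U" "openin X V" "openin X W"
        using D \<open>U \<in> D\<close> \<open>V \<in> D\<close> unfolding directed_opens_def by meson
      then show ?thesis
        using continuous_valuation_mono[OF \<mu>] continuous_valuation_mono[OF \<nu>]
        by (meson add_mono)
    qed
    then have "(SUP U\<in>D. \<mu> U + \<nu> U) = (SUP U\<in>D. \<mu> U) + (SUP U\<in>D. \<nu> U)"
      by (rule SUP_add_directed_ennreal)
    then show ?thesis
      using D \<mu> \<nu> unfolding continuous_valuation_def by simp
  qed
  moreover have "\<mu> U + \<nu> U + (\<mu> V + \<nu> V) = \<mu> (U \<union> V) + \<nu> (U \<union> V) + (\<mu> (U \<inter> V) + \<nu> (U \<inter> V))"
    if "openin X U" "openin X V" for U V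
  proof -
    have "(\<mu> U + \<mu> V) + (\<nu> U + \<nu> V) =
        (\<mu> (U \<union> V) + \<mu> (U \<inter> V)) + (\<nu> (U \<union> V) + \<nu> (U \<inter> V))"
      using that continuous_valuation_modular[OF \<mu>] continuous_valuation_modular[OF \<nu>]
      by (simp only:)
    then show ?thesis
      by (simp only: ac_simps)
  qed
  ultimately show ?thesis
    using \<mu> \<nu> unfolding continuous_valuation_def by (simp add: add_mono)
qed

lemma continuous_valuation_lincomb:
  assumes "continuous_valuation X \<mu>" "continuous_valuation X \<nu>"
  shows "continuous_valuation X (\<lambda>U. a * \<mu> U + b * \<nu> U)"
  using assms by (intro continuous_valuation_add continuous_valuation_scale)

text \<open>Common source of two valuations: a singleton \<open>C\<close> gives the Dirac valuation,
  an irreducible closed \<open>C\<close> the one that yields its generic point.\<close>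

lemma continuous_valuation_meets:
  assumes "\<And>U V. openin X U \<Longrightarrow> openin X V \<Longrightarrow> U \<inter> C \<noteq> {} \<Longrightarrow> V \<inter> C \<noteq> {} \<Longrightarrow> U \<inter> V \<inter> C \<noteq> {}"
  shows "continuous_valuation X (\<lambda>U. if openin X U \<and> U \<inter> C \<noteq> {} then 1 else 0)"
    (is "continuous_valuation X ?\<mu>")
proof -
  have "?\<mu> U + ?\<mu> V = ?\<mu> (U \<union> V) + ?\<mu> (U \<inter> V)" if "openin X U" "openin X V" for U V
  proof -
    \<comment> \<open>Meeting \<open>C\<close> turns intersections into conjunctions here and unions
      into disjunctions always; modularity is then an identity between truth values.\<close>
    have "U \<inter> V \<inter> C \<noteq> {} \<longleftrightarrow> U \<inter> C \<noteq> {} \<and> V \<inter> C \<noteq> {}"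
      using assms[OF that] by blast
    moreover have "(U \<union> V) \<inter> C \<noteq> {} \<longleftrightarrow> U \<inter> C \<noteq> {} \<or> V \<inter> C \<noteq> {}"
      by blast
    ultimately show ?thesis
      using that by (simp add: openin_Un openin_Int)
  qed
  moreover have "?\<mu> (\<Union>D) = (SUP U\<in>D. ?\<mu> U)" if D: "directed_opens X D" for D
  proof -
    have op: "openin X U" if "U \<in> D" for U
      using D that unfolding directed_opens_def by blast
    show ?thesis
    proof (cases "\<exists>U\<in>D. U \<inter> C \<noteq> {}")
      case True
      then obtain U where U: "U \<in> D" "U \<inter> C \<noteq> {}"
        by blast
      have "(SUP U\<in>D. ?\<mu> U) = 1"
      proof (rule antisym)
        show "(SUP U\<in>D. ?\<mu> U) \<le> 1"
          by (rule SUP_least) simp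
        have "?\<mu> U \<le> (SUP U\<in>D. ?\<mu> U)"
          using U(1) by (rule SUP_upper)
        then show "1 \<le> (SUP U\<in>D. ?\<mu> U)"
          using U op by simp
      qed
      moreover have "\<Union>D \<inter> C \<noteq> {}"
        using U by blast
      ultimately show ?thesis
        using op by (simp add: openin_Union)
    next
      case False
      then have "(SUP U\<in>D. ?\<mu> U) = (SUP U\<in>D. 0)"
        by (intro SUP_cong) auto
      moreover have "\<Union>D \<inter> C = {}"
        using False by blast
      moreover have "D \<noteq> {}"
        using D unfolding directed_opens_def by blast
      ultimately show ?thesis
        by simp
    qed
  qed
  moreover have "?\<mu> U \<le> ?\<mu> V" if "openin X U" "openin X V" "U \<subseteq> V" for U V
    using that by auto
  ultimately show ?thesis
    unfolding continuous_valuation_def by simp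
qed

lemma continuous_valuation_dirac: "continuous_valuation X (dirac X x)"
proof -
  have "dirac X x = (\<lambda>U. if openin X U \<and> U \<inter> {x} \<noteq> {} then 1 else 0)"
    unfolding dirac_def by auto
  moreover have "continuous_valuation X \<dots>"
    by (rule continuous_valuation_meets) blast
  ultimately show ?thesis
    by simp
qed

section \<open>Open sets of the weak topology\<close>

lemma openin_Vw_subbasic:
  assumes "openin X U" "0 \<le> r"
  shows "openin (Vw X) {\<mu> \<in> topspace (Vw X). \<mu> U > ennreal r}"
  unfolding topspace_Vw unfolding Vw_def
  by (rule topology_generated_by_Basis) (use assms in auto)

text \<open>Finite intersections of subbasic sets form a base, by induction on the generation of the
  topology. An open neighbourhood of a valuation can thus be read as finitely many strict lower
  bounds.\<close>

lemma openin_Vw_basicE: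
  assumes "openin (Vw X) W" "\<mu> \<in> W"
  obtains F where "finite F" "\<And>U r. (U, r) \<in> F \<Longrightarrow> openin X U \<and> 0 \<le> r \<and> \<mu> U > ennreal r"
    "{\<nu>. continuous_valuation X \<nu> \<and> (\<forall>(U, r)\<in>F. \<nu> U > ennreal r)} \<subseteq> W"
proof -
  have "generate_topology_on (insert {\<mu>. continuous_valuation X \<mu>}
       {{\<mu>. continuous_valuation X \<mu> \<and> \<mu> U > ennreal r} | U r. openin X U \<and> 0 \<le> r}) W"
    using assms(1) unfolding Vw_def by (rule openin_topology_generated_by)
  then have "\<mu> \<in> W \<longrightarrow> (\<exists>F. finite F \<and> (\<forall>(U, r)\<in>F. openin X U \<and> 0 \<le> r \<and> \<mu> U > ennreal r) \<and>
     {\<nu>. continuous_valuation X \<nu> \<and> (\<forall>(U, r)\<in>F. \<nu> U > ennreal r)} \<subseteq> W)"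
  proof induct
    case Empty
    then show ?case by simp
  next
    case (Int A B)
    show ?case
    proof
      assume "\<mu> \<in> A \<inter> B"
      then obtain F G where
        "finite F" "\<forall>(U, r)\<in>F. openin X U \<and> 0 \<le> r \<and> \<mu> U > ennreal r"
        "{\<nu>. continuous_valuation X \<nu> \<and> (\<forall>(U, r)\<in>F. \<nu> U > ennreal r)} \<subseteq> A"
        "finite G" "\<forall>(U, r)\<in>G. openin X U \<and> 0 \<le> r \<and> \<mu> U > ennreal r"
        "{\<nu>. continuous_valuation X \<nu> \<and> (\<forall>(U, r)\<in>G. \<nu> U > ennreal r)} \<subseteq> B"
        using Int by auto
      then show "\<exists>F. finite F \<and> (\<forall>(U, r)\<in>F. openin X U \<and> 0 \<le> r \<and> \<mu> U > ennreal r) \<and>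
          {\<nu>. continuous_valuation X \<nu> \<and> (\<forall>(U, r)\<in>F. \<nu> U > ennreal r)} \<subseteq> A \<inter> B"
        by (intro exI[of _ "F \<union> G"]) blast
    qed
  next
    case (UN K)
    show ?case
    proof
      assume "\<mu> \<in> \<Union>K"
      then obtain k where k: "k \<in> K" "\<mu> \<in> k"
        by blast
      obtain F where F: "finite F" "\<forall>(U, r)\<in>F. openin X U \<and> 0 \<le> r \<and> \<mu> U > ennreal r"
        "{\<nu>. continuous_valuation X \<nu> \<and> (\<forall>(U, r)\<in>F. \<nu> U > ennreal r)} \<subseteq> k"
        using UN(2)[OF k(1)] k(2) by (elim impE exE conjE)
      moreover have "k \<subseteq> \<Union>K"
        using k by blast
      ultimately show "\<exists>F. finite F \<and> (\<forall>(U, r)\<in>F. openin X U \<and> 0 \<le> r \<and> \<mu> U > ennreal r) \<and>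
          {\<nu>. continuous_valuation X \<nu> \<and> (\<forall>(U, r)\<in>F. \<nu> U > ennreal r)} \<subseteq> \<Union>K"
        by (meson order_trans)
    qed
  next
    case (Basis S)
    then consider "S = {\<mu>. continuous_valuation X \<mu>}"
      | U r where "S = {\<mu>. continuous_valuation X \<mu> \<and> \<mu> U > ennreal r}" "openin X U" "0 \<le> r"
      by blast
    then show ?case
    proof cases
      case 1
      then show ?thesis
        \<comment> \<open>The empty set of bounds cuts out the whole space, the generator added for
          the zero valuation.\<close>
        by (intro impI exI[of _ "{}"]) simp
    next
      case (2 U r)
      then show ?thesis
        by (intro impI exI[of _ "{(U, r)}"]) simp
    qed
  qed
  then show ?thesis
    using assms(2) that by blast
qed

lemma continuous_map_into_Vw:
  assumes "\<And>x. x \<in> topspace Y \<Longrightarrow> continuous_valuation X (f x)"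
    and "\<And>U r. openin X U \<Longrightarrow> 0 \<le> r \<Longrightarrow> openin Y {x \<in> topspace Y. f x U > ennreal r}"
  shows "continuous_map Y (Vw X) f"
  unfolding Vw_def
proof (rule continuous_on_generated_topo)
  fix S assume "S \<in> insert {\<mu>. continuous_valuation X \<mu>}
       {{\<mu>. continuous_valuation X \<mu> \<and> \<mu> U > ennreal r} | U r. openin X U \<and> 0 \<le> r}"
  then consider "S = {\<mu>. continuous_valuation X \<mu>}"
    | U r where "S = {\<mu>. continuous_valuation X \<mu> \<and> \<mu> U > ennreal r}" "openin X U" "0 \<le> r"
    by blast
  then show "openin Y (f -` S \<inter> topspace Y)"
  proof cases
    case 1
    then have "f -` S \<inter> topspace Y = topspace Y"
      using assms(1) by blast
    then show ?thesis
      by simp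
  next
    case (2 U r)
    then have "f -` S \<inter> topspace Y = {x \<in> topspace Y. f x U > ennreal r}"
      using assms(1) by blast
    then show ?thesis
      using assms(2) 2 by simp
  qed
qed (use assms(1) in blast)

text \<open>Basic open sets impose lower bounds only, so they are closed upwards in the pointwise
  order.\<close>

lemma open_Vw_upclosed:
  assumes W: "openin (Vw X) W" and \<mu>: "\<mu> \<in> W" and \<nu>: "continuous_valuation X \<nu>"
    and le: "\<And>U. openin X U \<Longrightarrow> \<mu> U \<le> \<nu> U"
  shows "\<nu> \<in> W"
proof -
  obtain F where F: "\<And>U r. (U, r) \<in> F \<Longrightarrow> openin X U \<and> 0 \<le> r \<and> \<mu> U > ennreal r"
    "{\<nu>. continuous_valuation X \<nu> \<and> (\<forall>(U, r)\<in>F. \<nu> U > ennreal r)} \<subseteq> W"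
    by (rule openin_Vw_basicE[OF W \<mu>]) (rule that)
  have "\<nu> U > ennreal r" if "(U, r) \<in> F" for U r
    using F(1)[OF that] le by (meson less_le_trans)
  then show ?thesis
    using F(2) \<nu> by blast
qed

section \<open>The multiplication on combinations of two Dirac valuations\<close>

text \<open>The set is the interval from 0 to \<open>c\<close>, of length \<open>c\<close>. This
  evaluates the integral of an evaluation map against a Dirac valuation.\<close>

lemma emeasure_ennreal_less: "emeasure lborel {r. 0 \<le> r \<and> ennreal r < c} = c"
proof (cases c)
  case (real s)
  then have "{r. 0 \<le> r \<and> ennreal r < c} = {0..<s}"
    by (auto simp: ennreal_less_iff)
  then show ?thesis
    using real by simp
next
  case top
  have "ennreal (real n) \<le> emeasure lborel {0::real..}" for n
  proof -
    have "emeasure lborel {0..real n} \<le> emeasure lborel {0::real..}"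
      by (rule emeasure_mono) auto
    then show ?thesis
      by simp
  qed
  \<comment> \<open>A finite measure would lie below some natural number.\<close>
  then have "\<not> emeasure lborel {0::real..} < of_nat n" for n
    by (simp add: ennreal_of_nat_eq_real_of_nat not_less)
  then have "emeasure lborel {0::real..} = \<infinity>"
    using ennreal_Ex_less_of_nat[of "emeasure lborel {0::real..}"]
    by (auto simp: less_top[symmetric])
  then show ?thesis
    using top by (simp add: atLeast_def less_top[symmetric])
qed

lemma ennreal_less_sets [measurable]: "{r. 0 \<le> r \<and> ennreal r < c} \<in> sets borel"
  by measurable

text \<open>A linear extension of the unit law of the monad: at level \<open>r\<close> the integrand
  is \<open>a\<close> times the truth value of r < \<mu>(U) plus \<open>b\<close> times that of r <
  \<nu>(U), and each truth value integrates to the value of the valuation.\<close>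

lemma Vw_mult_dirac_lincomb:
  assumes \<mu>: "continuous_valuation X \<mu>" and \<nu>: "continuous_valuation X \<nu>"
  shows "Vw_mult X (\<lambda>W. a * dirac (Vw X) \<mu> W + b * dirac (Vw X) \<nu> W) = (\<lambda>U. a * \<mu> U + b * \<nu> U)"
proof
  fix U
  show "Vw_mult X (\<lambda>W. a * dirac (Vw X) \<mu> W + b * dirac (Vw X) \<nu> W) U = a * \<mu> U + b * \<nu> U"
  proof (cases "openin X U")
    case False
    then show ?thesis
      using assms unfolding Vw_mult_def continuous_valuation_def by simp
  next
    case True
    let ?\<omega> = "\<lambda>W. a * dirac (Vw X) \<mu> W + b * dirac (Vw X) \<nu> W"
    have "val_integral (Vw X) ?\<omega> (\<lambda>\<mu>. \<mu> U) =
        (\<integral>\<^sup>+r. a * indicator {r. 0 \<le> r \<and> ennreal r < \<mu> U} r +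
              b * indicator {r. 0 \<le> r \<and> ennreal r < \<nu> U} r \<partial>lborel)"
      unfolding val_integral_def
    proof (rule nn_integral_cong)
      fix r :: real
      show "?\<omega> {\<mu> \<in> topspace (Vw X). \<mu> U > ennreal r} * indicator {0..} r =
          a * indicator {r. 0 \<le> r \<and> ennreal r < \<mu> U} r + b * indicator {r. 0 \<le> r \<and> ennreal r < \<nu> U} r"
      proof (cases "0 \<le> r")
        case r: True
        then show ?thesis
          using openin_Vw_subbasic[OF True r] \<mu> \<nu>
          by (simp add: dirac_def topspace_Vw indicator_def)
      qed (simp add: indicator_def)
    qed
    also have "\<dots> = a * \<mu> U + b * \<nu> U"
      by (simp add: nn_integral_add nn_integral_cmult emeasure_ennreal_less)
    finally show ?thesis
      using True unfolding Vw_mult_def by simp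
  qed
qed

text \<open>Naturality of the unit, extended linearly. Continuity of \<open>f\<close> makes
  preimages open, so \<open>dirac Y\<close> does not fall back to its default \<open>0\<close>
  there.\<close>

lemma Vw_map_dirac_lincomb:
  assumes f: "continuous_map Y X f" and "x \<in> topspace Y" "y \<in> topspace Y"
  shows "Vw_map Y X f (\<lambda>W. a * dirac Y x W + b * dirac Y y W) =
    (\<lambda>U. a * dirac X (f x) U + b * dirac X (f y) U)"
proof
  fix V
  show "Vw_map Y X f (\<lambda>W. a * dirac Y x W + b * dirac Y y W) V =
      a * dirac X (f x) V + b * dirac X (f y) V"
    using openin_continuous_map_preimage[OF f, of V] assms(2,3)
    by (simp add: Vw_map_def dirac_def)
qed

section \<open>Irreducible closed sets\<close>

lemma irreducible_closedD:
  assumes "irreducible_closed Y C"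
  shows "closedin Y C" "C \<subseteq> topspace Y" "C \<noteq> {}"
    "closedin Y A \<Longrightarrow> closedin Y B \<Longrightarrow> C \<subseteq> A \<union> B \<Longrightarrow> C \<subseteq> A \<or> C \<subseteq> B"
  using assms by (simp_all add: irreducible_closed_def closedin_subset)

text \<open>Otherwise the complements of \<open>U\<close> and \<open>V\<close> would cover
  \<open>C\<close>, and one of them alone would contain it.\<close>

lemma irreducible_closed_meets_Int:
  assumes C: "irreducible_closed Y C" and "openin Y U" "openin Y V" "U \<inter> C \<noteq> {}" "V \<inter> C \<noteq> {}"
  shows "U \<inter> V \<inter> C \<noteq> {}"
proof
  assume "U \<inter> V \<inter> C = {}"
  then have "C \<subseteq> (topspace Y - U) \<union> (topspace Y - V)"
    using irreducible_closedD(2)[OF C] by blast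
  moreover have "closedin Y (topspace Y - U)" "closedin Y (topspace Y - V)"
    by (intro closedin_diff closedin_topspace assms(2,3))+
  ultimately have "C \<subseteq> topspace Y - U \<or> C \<subseteq> topspace Y - V"
    using irreducible_closedD(4)[OF C] by simp
  then show False
    using assms(4,5) by blast
qed

text \<open>The factor \<open>topspace Y\<close> keeps the intersection open also for the empty
  family, where the claim is that \<open>C\<close> is nonempty.\<close>

lemma irreducible_closed_meets_finite_Inter:
  assumes "irreducible_closed Y C" "finite \<U>" "\<And>U. U \<in> \<U> \<Longrightarrow> openin Y U \<and> U \<inter> C \<noteq> {}"
  shows "topspace Y \<inter> \<Inter>\<U> \<inter> C \<noteq> {}"
  using assms(2,3)
proof (induction \<U>)
  case empty
  then show ?case
    using irreducible_closedD(2,3)[OF assms(1)] by auto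
next
  case (insert U \<U>)
  then have "openin Y (topspace Y \<inter> \<Inter>\<U>)"
    by (intro openin_Int_Inter) simp_all
  moreover have "topspace Y \<inter> \<Inter>\<U> \<inter> C \<noteq> {}"
    by (rule insert.IH) (simp add: insert.prems)
  moreover have "openin Y U" "U \<inter> C \<noteq> {}"
    using insert.prems by simp_all
  ultimately have "U \<inter> (topspace Y \<inter> \<Inter>\<U>) \<inter> C \<noteq> {}"
    using irreducible_closed_meets_Int[OF assms(1)] by simp
  then show ?case
    by (simp add: Int_ac)
qed

section \<open>Algebras\<close>

context
  fixes X :: "'a topology" and \<alpha> :: "('a set \<Rightarrow> ennreal) \<Rightarrow> 'a"
  assumes algebra: "Vw_algebra X \<alpha>"
begin

lemma algebra_continuous: "continuous_map (Vw X) X \<alpha>"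
  using algebra unfolding Vw_algebra_def by blast

lemma algebra_unit: "x \<in> topspace X \<Longrightarrow> \<alpha> (dirac X x) = x"
  using algebra unfolding Vw_algebra_def by blast

lemma algebra_in_topspace: "continuous_valuation X \<mu> \<Longrightarrow> \<alpha> \<mu> \<in> topspace X"
  using continuous_map_image_subset_topspace[OF algebra_continuous] topspace_Vw by blast

lemma openin_algebra_vimage:
  "openin X U \<Longrightarrow> openin (Vw X) {\<mu>. continuous_valuation X \<mu> \<and> \<alpha> \<mu> \<in> U}"
  using openin_continuous_map_preimage[OF algebra_continuous] by (simp add: topspace_Vw)

section \<open>Linearity of the structure map and the cone laws\<close>

text \<open>The multiplication law at \<open>?\<omega>\<close> equates the two sides:
  \<open>Vw_mult\<close> flattens \<open>?\<omega>\<close> to the left combination, and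
  \<open>Vw_map\<close> pushes it forward to the right one.\<close>

lemma algebra_lincomb:
  assumes "continuous_valuation X \<mu>" "continuous_valuation X \<nu>"
  shows "\<alpha> (\<lambda>U. a * \<mu> U + b * \<nu> U) = \<alpha> (\<lambda>U. a * dirac X (\<alpha> \<mu>) U + b * dirac X (\<alpha> \<nu>) U)"
proof -
  let ?\<omega> = "\<lambda>W. a * dirac (Vw X) \<mu> W + b * dirac (Vw X) \<nu> W"
  have "?\<omega> \<in> topspace (Vw (Vw X))"
    unfolding topspace_Vw by (simp add: continuous_valuation_lincomb continuous_valuation_dirac)
  then have "\<alpha> (Vw_mult X ?\<omega>) = \<alpha> (Vw_map (Vw X) X \<alpha> ?\<omega>)"
    using algebra unfolding Vw_algebra_def by blast
  then show ?thesis
    using assms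
    by (simp add: Vw_mult_dirac_lincomb Vw_map_dirac_lincomb[OF algebra_continuous] topspace_Vw)
qed

lemma algebra_add:
  assumes "continuous_valuation X \<mu>" "continuous_valuation X \<nu>"
  shows "alg_add X \<alpha> (\<alpha> \<mu>) (\<alpha> \<nu>) = \<alpha> (\<lambda>U. \<mu> U + \<nu> U)"
  using algebra_lincomb[OF assms, of 1 1] unfolding alg_add_def by simp

lemma algebra_smult:
  assumes "continuous_valuation X \<mu>"
  shows "alg_smult X \<alpha> r (\<alpha> \<mu>) = \<alpha> (\<lambda>U. ennreal r * \<mu> U)"
  \<comment> \<open>The coefficient \<open>0\<close> removes the second summand, for which \<mu>
    itself serves as a placeholder.\<close>
  using algebra_lincomb[OF assms assms, of "ennreal r" 0] unfolding alg_smult_def by simp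

lemma topspace_algebraE:
  assumes "x \<in> topspace X"
  obtains \<mu> where "continuous_valuation X \<mu>" "x = \<alpha> \<mu>"
  using assms algebra_unit continuous_valuation_dirac by metis

text \<open>Each point is written as the image of a valuation and the operations are moved inside
  \<alpha>; every law becomes an identity in \<open>ennreal\<close>.\<close>

lemma is_cone_algebra:
  "is_cone (topspace X) (alg_add X \<alpha>) (alg_zero \<alpha>) (alg_smult X \<alpha>)"
proof -
  note cv = continuous_valuation_add continuous_valuation_scale continuous_valuation_zero
  note lin = algebra_add algebra_smult cv
  have "comm_monoid \<lparr>carrier = topspace X, monoid.mult = alg_add X \<alpha>, one = alg_zero \<alpha>\<rparr>"
    by (rule comm_monoidI)
      (auto elim!: topspace_algebraE simp: lin alg_zero_def algebra_in_topspace add.assoc,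
       simp add: add.commute)
  moreover have "\<forall>r\<ge>0. \<forall>x\<in>topspace X. alg_smult X \<alpha> r x \<in> topspace X"
    by (auto elim!: topspace_algebraE simp: lin algebra_in_topspace)
  moreover have "\<forall>r\<ge>0. \<forall>x\<in>topspace X. \<forall>y\<in>topspace X. alg_smult X \<alpha> r (alg_add X \<alpha> x y) =
      alg_add X \<alpha> (alg_smult X \<alpha> r x) (alg_smult X \<alpha> r y)"
    by (auto elim!: topspace_algebraE simp: lin distrib_left)
  \<comment> \<open>The signs matter here and in the next law: \<open>ennreal\<close> sends negative
    reals to 0 and is additive and multiplicative on nonnegative ones.\<close>
  moreover have "\<forall>r\<ge>0. \<forall>s\<ge>0. \<forall>x\<in>topspace X. alg_smult X \<alpha> (r + s) x =
      alg_add X \<alpha> (alg_smult X \<alpha> r x) (alg_smult X \<alpha> s x)"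
    by (auto elim!: topspace_algebraE simp: lin distrib_right)
  moreover have "\<forall>r\<ge>0. \<forall>s\<ge>0. \<forall>x\<in>topspace X. alg_smult X \<alpha> (r * s) x =
      alg_smult X \<alpha> r (alg_smult X \<alpha> s x)"
    by (auto elim!: topspace_algebraE simp: lin ennreal_mult mult.assoc)
  moreover have "\<forall>x\<in>topspace X. alg_smult X \<alpha> 1 x = x" "\<forall>x\<in>topspace X. alg_smult X \<alpha> 0 x = alg_zero \<alpha>"
    by (auto elim!: topspace_algebraE simp: lin alg_zero_def)
  moreover have "\<forall>r\<ge>0. alg_smult X \<alpha> r (alg_zero \<alpha>) = alg_zero \<alpha>"
    by (simp add: alg_zero_def lin)
  ultimately show ?thesis
    unfolding is_cone_def by blast
qed

section \<open>Joint continuity of the operations\<close>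

lemma continuous_map_alg_add:
  "continuous_map (prod_topology X X) X (\<lambda>(x, y). alg_add X \<alpha> x y)"
proof -
  have "continuous_map (prod_topology X X) (Vw X) (\<lambda>(x, y) U. dirac X x U + dirac X y U)"
  proof (rule continuous_map_into_Vw)
    fix U and r :: real assume U: "openin X U" and r: "0 \<le> r"
    let ?S = "{p \<in> topspace (prod_topology X X).
      (case p of (x, y) \<Rightarrow> \<lambda>U. dirac X x U + dirac X y U) U > ennreal r}"
    have sub: "U \<subseteq> topspace X"
      using U by (rule openin_subset)
    have one: "ennreal r < 1 \<longleftrightarrow> r < 1" and two: "ennreal r < 2 \<longleftrightarrow> r < 2"
      using r by (simp_all flip: ennreal_1 ennreal_numeral add: ennreal_less_iff)
    \<comment> \<open>The sum of two Dirac valuations takes only the values 0, 1 and 2 on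
      \<open>U\<close>, so the preimage changes only at the thresholds 1 and 2.\<close>
    consider "r < 1" | "1 \<le> r" "r < 2" | "2 \<le> r"
      by linarith
    then have "?S = U \<times> topspace X \<union> topspace X \<times> U \<or> ?S = U \<times> U \<or> ?S = {}"
    proof cases
      case 1
      then have "?S = U \<times> topspace X \<union> topspace X \<times> U"
        using sub U one two by (auto simp: dirac_def split: if_splits)
      then show ?thesis ..
    next
      case 2
      then have "?S = U \<times> U"
        using sub U one two by (auto simp: dirac_def split: if_splits)
      then show ?thesis by blast
    next
      case 3
      then have "?S = {}"
        using sub U one two by (auto simp: dirac_def split: if_splits)
      then show ?thesis by blast
    qed
    moreover have "openin (prod_topology X X) (U \<times> topspace X \<union> topspace X \<times> U)"
      "openin (prod_topology X X) (U \<times> U)"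
      using U by (auto simp: openin_prod_Times_iff intro!: openin_Un)
    ultimately show "openin (prod_topology X X) ?S"
      by (elim disjE) (simp_all only: openin_empty)
  qed (auto intro: continuous_valuation_add continuous_valuation_dirac)
  from continuous_map_compose[OF this algebra_continuous] show ?thesis
    by (simp add: alg_add_def comp_def case_prod_unfold)
qed

lemma continuous_map_alg_smult:
  "continuous_map (prod_topology scott_nonneg X) X (\<lambda>(r, x). alg_smult X \<alpha> r x)"
proof -
  have "continuous_map (prod_topology scott_nonneg X) (Vw X) (\<lambda>(r, x) U. ennreal r * dirac X x U)"
  proof (rule continuous_map_into_Vw)
    fix U and s :: real assume U: "openin X U" and s: "0 \<le> s"
    \<comment> \<open>The value is r if x lies in U and 0 otherwise; as s is nonnegative, exceeding
      s requires both x in U and r > s, which is an open rectangle.\<close>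
    have "{p \<in> topspace (prod_topology scott_nonneg X).
        (case p of (r, x) \<Rightarrow> \<lambda>U. ennreal r * dirac X x U) U > ennreal s} = {s<..} \<times> U"
      using openin_subset[OF U] U s
      by (auto simp: dirac_def topspace_scott_nonneg ennreal_less_iff split: if_splits)
    moreover have "openin scott_nonneg {s<..}"
      using s unfolding openin_scott_nonneg by blast
    ultimately show "openin (prod_topology scott_nonneg X) {p \<in> topspace (prod_topology scott_nonneg X).
        (case p of (r, x) \<Rightarrow> \<lambda>U. ennreal r * dirac X x U) U > ennreal s}"
      using U by (simp add: openin_prod_Times_iff)
  qed (auto intro: continuous_valuation_scale continuous_valuation_dirac)
  from continuous_map_compose[OF this algebra_continuous] show ?thesis
    by (simp add: alg_smult_def comp_def case_prod_unfold)
qed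

section \<open>Weak local convexity\<close>

lemma weakly_locally_convex_algebra:
  "weakly_locally_convex X (alg_add X \<alpha>) (alg_smult X \<alpha>)"
  unfolding weakly_locally_convex_def neighbourhood_base_of
proof (intro allI impI, elim conjE)
  fix W x assume W: "openin X W" and x: "x \<in> W"
  have "x \<in> topspace X"
    using openin_subset[OF W] x by blast
  then have "dirac X x \<in> {\<mu>. continuous_valuation X \<mu> \<and> \<alpha> \<mu> \<in> W}"
    using x by (simp add: algebra_unit continuous_valuation_dirac)
  then obtain F where fin: "finite F"
    and F: "\<And>U r. (U, r) \<in> F \<Longrightarrow> openin X U \<and> 0 \<le> r \<and> dirac X x U > ennreal r"
    and sub: "{\<nu>. continuous_valuation X \<nu> \<and> (\<forall>(U, r)\<in>F. \<nu> U > ennreal r)}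
      \<subseteq> {\<mu>. continuous_valuation X \<mu> \<and> \<alpha> \<mu> \<in> W}"
    by (rule openin_Vw_basicE[OF openin_algebra_vimage[OF W]]) (rule that)
  \<comment> \<open>The convex neighbourhood will be the image of \<open>B\<close> under \<alpha>,
    which need not be open.\<close>
  define B where "B = {\<nu>. continuous_valuation X \<nu> \<and> (\<forall>(U, r)\<in>F. \<nu> U > ennreal r)}"
  \<comment> \<open>These are the points whose Dirac valuation lies in \<open>B\<close>: all bounds
    are below 1, so only membership in the finitely many open sets counts.\<close>
  define N where "N = topspace X \<inter> \<Inter>(fst ` F)"
  have pos: "ennreal r < 1 \<and> x \<in> U" if "(U, r) \<in> F" for U r
    using F[OF that] by (auto simp: dirac_def split: if_splits)
  have "openin X N"
    unfolding N_def using fin F by (intro openin_Int_Inter) auto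
  moreover have "x \<in> N"
    unfolding N_def using pos \<open>x \<in> topspace X\<close> by auto
  moreover have "N \<subseteq> \<alpha> ` B"
  proof
    fix y assume y: "y \<in> N"
    have "dirac X y U > ennreal r" if "(U, r) \<in> F" for U r
    proof -
      have "y \<in> U"
        using y that unfolding N_def by force
      then show ?thesis
        using F[OF that] pos[OF that] by (simp add: dirac_def)
    qed
    then have "dirac X y \<in> B"
      unfolding B_def by (auto simp: continuous_valuation_dirac)
    moreover have "y = \<alpha> (dirac X y)"
      using y by (simp add: N_def algebra_unit)
    ultimately show "y \<in> \<alpha> ` B"
      by blast
  qed
  moreover have "\<alpha> ` B \<subseteq> W"
    using sub unfolding B_def by blast
  moreover have "cone_convex (alg_add X \<alpha>) (alg_smult X \<alpha>) (\<alpha> ` B)"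
    unfolding cone_convex_def
  proof (intro ballI)
    fix a b and t :: real
    assume "a \<in> \<alpha> ` B" "b \<in> \<alpha> ` B" and t: "t \<in> {0..1}"
    then obtain \<mu> \<nu> where \<mu>: "\<mu> \<in> B" "a = \<alpha> \<mu>" and \<nu>: "\<nu> \<in> B" "b = \<alpha> \<nu>"
      by blast
    have cv: "continuous_valuation X \<mu>" "continuous_valuation X \<nu>"
      using \<mu> \<nu> unfolding B_def by simp_all
    let ?\<rho> = "\<lambda>U. ennreal t * \<mu> U + ennreal (1 - t) * \<nu> U"
    have "?\<rho> U > ennreal r" if "(U, r) \<in> F" for U r
    proof -
      \<comment> \<open>Both values dominate the minimum, which is a convex combination of itself;
        the strict bound thus survives zero coefficients and infinite values.\<close>
      let ?m = "min (\<mu> U) (\<nu> U)"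
      have "ennreal r < ?m"
        using \<mu> \<nu> that unfolding B_def by auto
      also have "?m = (ennreal t + ennreal (1 - t)) * ?m"
        using t by (simp flip: ennreal_plus)
      also have "\<dots> = ennreal t * ?m + ennreal (1 - t) * ?m"
        by (rule distrib_right)
      also have "\<dots> \<le> ?\<rho> U"
        by (intro add_mono mult_left_mono) simp_all
      finally show ?thesis .
    qed
    then have "?\<rho> \<in> B"
      unfolding B_def using continuous_valuation_lincomb[OF cv] by auto
    moreover have "alg_add X \<alpha> (alg_smult X \<alpha> t a) (alg_smult X \<alpha> (1 - t) b) = \<alpha> ?\<rho>"
      using cv \<mu> \<nu> by (simp add: algebra_smult algebra_add continuous_valuation_scale)
    ultimately show "alg_add X \<alpha> (alg_smult X \<alpha> t a) (alg_smult X \<alpha> (1 - t) b) \<in> \<alpha> ` B"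
      by simp
  qed
  ultimately show "\<exists>U V. openin X U \<and> cone_convex (alg_add X \<alpha>) (alg_smult X \<alpha>) V \<and>
      x \<in> U \<and> U \<subseteq> V \<and> V \<subseteq> W"
    by blast
qed

section \<open>Sobriety\<close>

lemma sober_space_algebra: "sober_space X"
  unfolding sober_space_def
proof (intro allI impI)
  fix C assume C: "irreducible_closed X C"
  have clC: "closedin X C" and CX: "C \<subseteq> topspace X"
    using irreducible_closedD[OF C] by simp_all
  define \<mu> where "\<mu> = (\<lambda>U. if openin X U \<and> U \<inter> C \<noteq> {} then 1 else 0 :: ennreal)"
  have \<mu>: "continuous_valuation X \<mu>"
    unfolding \<mu>_def using irreducible_closed_meets_Int[OF C] by (rule continuous_valuation_meets)
  \<comment> \<open>This puts \<alpha>(\<mu>) into the closure of \<open>C\<close>, hence into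
    \<open>C\<close>.\<close>
  have meets: "U \<inter> C \<noteq> {}" if U: "openin X U" "\<alpha> \<mu> \<in> U" for U
  proof -
    have "\<mu> \<in> {\<mu>. continuous_valuation X \<mu> \<and> \<alpha> \<mu> \<in> U}"
      using \<mu> U by simp
    then obtain F where fin: "finite F"
      and F: "\<And>V r. (V, r) \<in> F \<Longrightarrow> openin X V \<and> 0 \<le> r \<and> \<mu> V > ennreal r"
      and sub: "{\<nu>. continuous_valuation X \<nu> \<and> (\<forall>(V, r)\<in>F. \<nu> V > ennreal r)}
        \<subseteq> {\<mu>. continuous_valuation X \<mu> \<and> \<alpha> \<mu> \<in> U}"
      by (rule openin_Vw_basicE[OF openin_algebra_vimage[OF U(1)]]) (rule that)
    have pos: "ennreal r < 1 \<and> V \<inter> C \<noteq> {}" if "(V, r) \<in> F" for V r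
      using F[OF that] by (auto simp: \<mu>_def split: if_splits)
    \<comment> \<open>A basic neighbourhood of \<mu> only asks that finitely many open sets meet
      \<open>C\<close>. Irreducibility gives them a common point in \<open>C\<close>, whose Dirac
      valuation lies in the same neighbourhood.\<close>
    have "topspace X \<inter> \<Inter>(fst ` F) \<inter> C \<noteq> {}"
      using fin F pos by (intro irreducible_closed_meets_finite_Inter[OF C]) auto
    then obtain y where y: "y \<in> topspace X" "y \<in> C" "\<And>V r. (V, r) \<in> F \<Longrightarrow> y \<in> V"
      by fastforce
    have "dirac X y V > ennreal r" if "(V, r) \<in> F" for V r
      using F[OF that] pos[OF that] y(3)[OF that] by (simp add: dirac_def)
    then have "dirac X y \<in> {\<nu>. continuous_valuation X \<nu> \<and> (\<forall>(V, r)\<in>F. \<nu> V > ennreal r)}"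
      by (auto simp: continuous_valuation_dirac)
    then have "\<alpha> (dirac X y) \<in> U"
      using subsetD[OF sub] by simp
    then show ?thesis
      using y(1,2) algebra_unit by auto
  qed
  have "\<alpha> \<mu> \<in> X closure_of C"
    unfolding in_closure_of using meets algebra_in_topspace[OF \<mu>] by blast
  then have "\<alpha> \<mu> \<in> C"
    using clC by (simp add: closure_of_closedin)
  \<comment> \<open>For y in \<open>C\<close> the Dirac valuation lies below \<mu>. Since open sets
    of valuations are closed upwards, every open set around y also contains \<alpha>(\<mu>).\<close>
  moreover have "y \<in> X closure_of {\<alpha> \<mu>}" if y: "y \<in> C" for y
    unfolding in_closure_of
  proof (intro conjI allI impI)
    show "y \<in> topspace X"
      using CX y by blast
    fix U assume U: "y \<in> U \<and> openin X U"
    have "\<mu> \<in> {\<mu>. continuous_valuation X \<mu> \<and> \<alpha> \<mu> \<in> U}"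
    proof (rule open_Vw_upclosed[OF openin_algebra_vimage _ \<mu>])
      show "dirac X y \<in> {\<mu>. continuous_valuation X \<mu> \<and> \<alpha> \<mu> \<in> U}"
        using U \<open>y \<in> topspace X\<close> by (simp add: algebra_unit continuous_valuation_dirac)
      show "dirac X y V \<le> \<mu> V" for V
        using y by (auto simp: dirac_def \<mu>_def)
    qed (use U in blast)
    then show "\<exists>z. z \<in> {\<alpha> \<mu>} \<and> z \<in> U"
      by blast
  qed
  ultimately have eq: "C = X closure_of {\<alpha> \<mu>}"
    using clC closure_of_minimal[of "{\<alpha> \<mu>}" C X] by blast
  have t0: "t0_space X"
    using algebra unfolding Vw_algebra_def by blast
  have "x = \<alpha> \<mu>" if x: "x \<in> topspace X" "C = X closure_of {x}" for x
  proof (rule ccontr)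
    assume "x \<noteq> \<alpha> \<mu>"
    \<comment> \<open>The equivalence says that \<open>U\<close> contains exactly one of the two
      points, whereas equal closures force the same open neighbourhoods.\<close>
    then obtain U where "openin X U" "x \<notin> U \<longleftrightarrow> \<alpha> \<mu> \<in> U"
      using t0 x(1) algebra_in_topspace[OF \<mu>] unfolding t0_space_def by metis
    moreover have "x \<in> X closure_of {\<alpha> \<mu>}" "\<alpha> \<mu> \<in> X closure_of {x}"
      using eq x \<open>\<alpha> \<mu> \<in> C\<close> closure_of_subset[of "{x}" X] by auto
    ultimately show False
      unfolding in_closure_of by blast
  qed
  then show "\<exists>!x. x \<in> topspace X \<and> C = X closure_of {x}"
    using eq algebra_in_topspace[OF \<mu>] by blast
qed

end

theorem proposition4p9:
  fixes X :: "'a topology" and \<alpha> :: "('a set \<Rightarrow> ennreal) \<Rightarrow> 'a"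
  assumes "Vw_algebra X \<alpha>"
  shows "topological_cone X (alg_add X \<alpha>) (alg_zero \<alpha>) (alg_smult X \<alpha>) \<and>
         weakly_locally_convex X (alg_add X \<alpha>) (alg_smult X \<alpha>) \<and>
         sober_space X"
proof -
  have "t0_space X"
    using assms unfolding Vw_algebra_def by blast
  then show ?thesis
    unfolding topological_cone_def
    using is_cone_algebra[OF assms] continuous_map_alg_add[OF assms]
      continuous_map_alg_smult[OF assms] weakly_locally_convex_algebra[OF assms]
      sober_space_algebra[OF assms]
    by blast
qed

end
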